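(* Let $m\in\mathbb{N}$ and let $s$ be an integer with $2\le s\le m-1$ and $\gcd(s,m)=1$. Let $u=[u_1,\dots,u_m]^T\in\mathbb{C}^m$ with $u_1,\dots,u_m\neq 0$, and let $C(u,\pi_s)=\sum_{r=0}^{k}c_rP(u,\pi_s)^r$ (with $k\in\mathbb{N}$ and $c_0,\dots,c_k\in\mathbb{C}$) be a generalized circulant matrix of order $m$ corresponding to $P(u,\pi_s)$. Let $\lambda=\sqrt[m]{\prod_{i=1}^m u_i}$ and $\omega=\exp\left(\frac{2\pi \mathrm{i}}{m}\right)$. Let $[t_1,t_2,\dots,t_m]^T$ be an eigenvector of $P(u,\pi_s)$ associated with $\lambda$. Then the columns of the $m\times m$ matrix $$\left(\omega^{i(j-1)}t_i\right)_{1\le i,j\le m}=\begin{pmatrix} t_1 & t_1\omega & t_1\omega^2 & \cdots & t_1\omega^{m-1}\\ t_2 & t_2\omega^2 & t_2\omega^{2\cdot 2} & \cdots & t_2\omega^{2(m-1)}\\ \vdots & \vdots & \vdots & \ddots & \vdots\\ t_{m-1} & t_{m-1}\omega^{m-1} & t_{m-1}\omega^{(m-1)\cdot 2} & \cdots & t_{m-1}\omega^{(m-1)(m-1)}\\ t_m & t_m & t_m & \cdots & t_m\end{pmatrix}$$ (whose first column is the given eigenvector) form a basis (of $\mathbb{C}^m$) of eigenvectors of $C(u,\pi_s)$.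
   Context: For $s\in\{0,1,\dots,m-1\}$, $\pi_s$ is the permutation $\pi_s(x)=(x+s)\ (\mathrm{mod}\ m)$ of the indices modulo $m$; row and column indices of $m\times m$ matrices are taken in $\{1,\dots,m\}$, with residue $0$ identified with $m$. The permutation matrix $P_{\pi}=(p_{i,j})$ has $p_{i,j}=1$ if $j=\pi(i)$ and $0$ otherwise. For $u\in\mathbb{C}^m$, $P(u,\pi_s)=D_uP_{\pi_s}$ with $D_u=\mathrm{diag}(u_1,\dots,u_m)$; thus the only nonzero entry of row $i$ of $P(u,\pi_s)$ is $u_i$, in column $\pi_s(i)$. A generalized circulant matrix corresponding to $P(u,\pi_s)$ is a matrix $C(u,\pi_s)=\sum_{r=0}^{k}c_rP(u,\pi_s)^r$ with $k\in\mathbb{N}$ and $c_r\in\mathbb{C}$. The symbol $\sqrt[m]{z}$ denotes a fixed complex $m$-th root of $z$. The imaginary unit is $\mathrm{i}$. *)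

theory Defs
  imports Complex_Main "Jordan_Normal_Form.Char_Poly" "Jordan_Normal_Form.VS_Connect"
begin

text \<open>
  Matrix and vector positions are counted from 0 in the library, whereas the permutations below act
  on the indices 1, ..., m.  Position i of a matrix or vector therefore stands for the index i + 1.
\<close>

text \<open>The shift by s on 1, ..., m, the residue 0 being represented by m.\<close>
definition cyclic_shift :: "nat \<Rightarrow> nat \<Rightarrow> nat \<Rightarrow> nat" where
  "cyclic_shift m s x = (if (x + s) mod m = 0 then m else (x + s) mod m)"

definition perm_mat :: "nat \<Rightarrow> (nat \<Rightarrow> nat) \<Rightarrow> complex mat" where
  "perm_mat m p = mat m m (\<lambda>(i, j). if j + 1 = p (i + 1) then 1 else 0)"

definition weighted_perm_mat :: "complex vec \<Rightarrow> (nat \<Rightarrow> nat) \<Rightarrow> complex mat" where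
  "weighted_perm_mat u p = mat_diag (dim_vec u) (\<lambda>i. u $ i) * perm_mat (dim_vec u) p"

text \<open>
  The sum of the matrices c r P^r over r = 0, ..., k, where P is the weighted permutation matrix of
  u and p.  Matrices of all sizes share one type, so the sum is taken in the module of square
  matrices of order dim_vec u.
\<close>
definition gen_circulant ::
    "complex vec \<Rightarrow> (nat \<Rightarrow> nat) \<Rightarrow> nat \<Rightarrow> (nat \<Rightarrow> complex) \<Rightarrow> complex mat" where
  "gen_circulant u p k c =
     finsum (module_mat TYPE(complex) (dim_vec u) (dim_vec u))
       (\<lambda>r. c r \<cdot>\<^sub>m (weighted_perm_mat u p ^\<^sub>m r)) {0..k}"

text \<open>
  A family of vectors of length n is a basis of the n-dimensional complex column space.  Bases are
  sets in the library; distinctness excludes repetitions within the family.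
\<close>
definition basis_list :: "nat \<Rightarrow> complex vec list \<Rightarrow> bool" where
  "basis_list n vs \<longleftrightarrow>
     distinct vs \<and> vectorspace.basis class_ring (module_vec TYPE(complex) n) (set vs)"

lemma weighted_perm_mat_index:
  assumes "i < dim_vec u" "j < dim_vec u"
  shows "weighted_perm_mat u p $$ (i, j) = (if j + 1 = p (i + 1) then u $ i else 0)"
proof -
  have "perm_mat (dim_vec u) p \<in> carrier_mat (dim_vec u) (dim_vec u)"
    by (simp add: perm_mat_def)
  then show ?thesis
    using assms by (simp add: weighted_perm_mat_def mat_diag_mult_left) (simp add: perm_mat_def)
qed

end

theory Submission
  imports Defs "HOL-Number_Theory.Cong"
begin

text \<open>
  Write P for the weighted shift, so that row i of P v is u i times the entry of v at i + s
  modulo m.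
  Multiplying an eigenvector t entrywise by the character i \<mapsto> \<omega> ^ (i j) of the integers modulo m
  changes the entry at i + s, relative to the one at i, by the constant factor \<omega> ^ (s j).  The result
  is therefore again an eigenvector of P, for the eigenvalue \<omega> ^ (s j) lam
  (\<open>weighted_shift_eigenvector_twist\<close>).

  Since s is prime to m and \<omega> is a primitive m-th root of unity, the numbers \<omega> ^ (s j) with j < m are
  distinct (\<open>inj_on_root_unity_powers\<close>).  The weights are nonzero, hence so is lam, and the m twisted
  vectors belong to m distinct eigenvalues.  Eigenvectors for distinct eigenvalues are linearly
  independent (\<open>eigenvectors_lin_indpt\<close>), and m independent vectors form a basis of the m-dimensional
  space.  Finally, C is a polynomial in P, so it keeps every eigenvector of P
  (\<open>gen_circulant_eigenvector\<close>).
\<close>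

section \<open>Eigenvectors for distinct eigenvalues\<close>

text \<open>
  The independence proof is by annihilation: in a vanishing combination of eigenvectors, applying
  A - z multiplies the coefficient of each v by \<open>\<mu> v - z\<close>.  Letting z run through all
  eigenvalues but one isolates a single summand.  This lemma performs these applications on the level
  of entries, for the eigenvalues of all members of F.
\<close>

lemma eigenvector_combination_annihilate:
  fixes A :: "'a :: field mat"
  assumes A: "A \<in> carrier_mat n n"
    and ev: "\<And>v. v \<in> B \<Longrightarrow> eigenvector A v (\<mu> v)"
    and zero: "\<And>i. i < n \<Longrightarrow> (\<Sum>v\<in>B. a v * v $ i) = 0"
    and "finite F" "i < n"
  shows "(\<Sum>v\<in>B. a v * (\<Prod>w\<in>F. \<mu> v - \<mu> w) * v $ i) = 0"
  using \<open>finite F\<close> \<open>i < n\<close>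
proof (induction F arbitrary: i rule: finite_induct)
  case empty
  then show ?case using zero by simp
next
  case (insert x F)
  define b where "b v = a v * (\<Prod>w\<in>F. \<mu> v - \<mu> w)" for v
  have IH: "(\<Sum>v\<in>B. b v * v $ l) = 0" if "l < n" for l
    using insert.IH[OF that] by (simp add: b_def)
  have entry: "\<mu> v * v $ i = (\<Sum>l<n. A $$ (i, l) * v $ l)" if "v \<in> B" for v
  proof -
    have v: "v \<in> carrier_vec n" and eq: "A *\<^sub>v v = \<mu> v \<cdot>\<^sub>v v"
      using ev[OF that] A by (auto simp: eigenvector_def)
    have "\<mu> v * v $ i = (A *\<^sub>v v) $ i"
      using v insert.prems by (simp add: eq)
    also have "\<dots> = (\<Sum>l<n. A $$ (i, l) * v $ l)"
      using v insert.prems A by (auto simp: scalar_prod_def lessThan_atLeast0)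
    finally show ?thesis .
  qed
  have "(\<Sum>v\<in>B. b v * (\<mu> v * v $ i)) = (\<Sum>v\<in>B. \<Sum>l<n. A $$ (i, l) * (b v * v $ l))"
    by (rule sum.cong) (simp_all add: entry sum_distrib_left mult.left_commute)
  also have "\<dots> = (\<Sum>l<n. A $$ (i, l) * (\<Sum>v\<in>B. b v * v $ l))"
    by (subst sum.swap) (simp add: sum_distrib_left)
  also have "\<dots> = 0"
    using IH by simp
  finally have mu: "(\<Sum>v\<in>B. b v * (\<mu> v * v $ i)) = 0" .
  have "(\<Sum>v\<in>B. a v * (\<Prod>w\<in>insert x F. \<mu> v - \<mu> w) * v $ i)
      = (\<Sum>v\<in>B. b v * (\<mu> v * v $ i) - \<mu> x * (b v * v $ i))"
    by (rule sum.cong) (use insert.hyps in \<open>simp_all add: b_def algebra_simps\<close>)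
  also have "\<dots> = 0"
    using mu IH[OF insert.prems] by (simp add: sum_subtractf flip: sum_distrib_left)
  finally show ?case .
qed

lemma (in vec_space) eigenvectors_lin_indpt:
  assumes A: "A \<in> carrier_mat n n"
    and ev: "\<And>v. v \<in> S \<Longrightarrow> eigenvector A v (\<mu> v)"
    and inj: "inj_on \<mu> S"
  shows "lin_indpt S"
proof
  assume "lin_dep S"
  then obtain B a v where B: "finite B" "B \<subseteq> S" and lc: "lincomb a B = 0\<^sub>v n"
    and v: "v \<in> B" and av: "a v \<noteq> 0"
    unfolding lin_dep_def by auto
  have BC: "B \<subseteq> carrier_vec n"
    using ev B A by (auto simp: eigenvector_def)
  have zero: "(\<Sum>w\<in>B. a w * w $ i) = 0" if "i < n" for i
    using lincomb_index[OF that BC, of a] lc that by simp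
  \<comment> \<open>The factor p kills the coefficients of all members of B except v.\<close>
  define p where "p w = (\<Prod>x\<in>B - {v}. \<mu> w - \<mu> x)" for w
  have pv: "p v \<noteq> 0"
    using B v inj by (auto simp: p_def inj_on_def)
  have p0: "p w = 0" if "w \<in> B - {v}" for w
    unfolding p_def by (rule prod_zero) (use B that in auto)
  have "v $ i = 0" if "i < n" for i
  proof -
    have "(\<Sum>w\<in>B. a w * p w * w $ i) = 0"
      unfolding p_def
      by (rule eigenvector_combination_annihilate[OF A _ zero]) (use ev B that in auto)
    moreover have "(\<Sum>w\<in>B. a w * p w * w $ i) = a v * p v * v $ i"
      using B v p0 by (subst sum.remove[of _ v]) auto
    ultimately show ?thesis
      using av pv by simp
  qed
  then have "v = 0\<^sub>v n"
    using BC v by (intro eq_vecI) auto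
  then show False
    using ev[of v] B v A by (auto simp: eigenvector_def)
qed

lemma eigenvector_eigenvalue_unique:
  fixes A :: "'a :: field mat"
  assumes "eigenvector A v k" "eigenvector A v l"
  shows "k = l"
proof -
  have v: "v \<in> carrier_vec (dim_row A)" "v \<noteq> 0\<^sub>v (dim_row A)" and eq: "k \<cdot>\<^sub>v v = l \<cdot>\<^sub>v v"
    using assms by (auto simp: eigenvector_def)
  then obtain i where i: "i < dim_row A" "v $ i \<noteq> 0"
    by (metis carrier_vecD eq_vecI index_zero_vec)
  then have "k * v $ i = l * v $ i"
    using arg_cong[OF eq, of "\<lambda>w. w $ i"] v by simp
  then show ?thesis
    using i by simp
qed

text \<open>
  Distinct eigenvalues also make the family free of repetitions.  Independence is stated for a set of
  vectors, so the eigenvalue has to become a function of the vector, which the inverse g of f provides.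
\<close>

lemma basis_list_eigenvectors:
  assumes A: "A \<in> carrier_mat n n"
    and ev: "\<And>j. j < n \<Longrightarrow> eigenvector A (f j) (e j)"
    and inj: "inj_on e {..<n}"
  shows "basis_list n (map f [0..<n])"
proof -
  interpret vec_space "TYPE(complex)" n .
  have inj_f: "inj_on f {..<n}"
  proof (rule inj_onI)
    fix j l assume "j \<in> {..<n}" "l \<in> {..<n}" "f j = f l"
    then show "j = l"
      using ev[of j] ev[of l] eigenvector_eigenvalue_unique[of A "f j" "e j" "e l"] inj
      by (auto simp: inj_on_def)
  qed
  define g where "g = the_inv_into {..<n} f"
  have g: "g (f j) = j" if "j < n" for j
    using the_inv_into_f_f[OF inj_f] that by (simp add: g_def)
  have ind: "lin_indpt (f ` {..<n})"
    by (rule eigenvectors_lin_indpt[OF A, where \<mu> = "\<lambda>v. e (g v)"])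
      (use ev g inj in \<open>auto simp: inj_on_def\<close>)
  have sub: "f ` {..<n} \<subseteq> carrier_vec n"
    using ev A by (auto simp: eigenvector_def)
  have "basis (f ` {..<n})"
    by (rule dim_li_is_basis) (use ind sub inj_f in \<open>auto simp: dim_is_n card_image\<close>)
  then show ?thesis
    using inj_f by (simp add: basis_list_def distinct_map lessThan_atLeast0)
qed

section \<open>Polynomials in a matrix\<close>

text \<open>
  The carrier statement is proved together with the action on w because the induction step adds
  matrices inside the module of n by n matrices.
\<close>

lemma finsum_mat_mult_vec:
  fixes w :: "'a :: comm_ring_1 vec"
  assumes "finite K" and f: "\<And>r. r \<in> K \<Longrightarrow> f r \<in> carrier_mat n n"
    and w: "w \<in> carrier_vec n"
    and fw: "\<And>r. r \<in> K \<Longrightarrow> f r *\<^sub>v w = g r \<cdot>\<^sub>v w"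
  shows "finsum (module_mat TYPE('a) n n) f K \<in> carrier_mat n n \<and>
    finsum (module_mat TYPE('a) n n) f K *\<^sub>v w = (\<Sum>r\<in>K. g r) \<cdot>\<^sub>v w"
proof -
  interpret abelian_group "module_mat TYPE('a) n n"
    by (rule abelian_group_mat)
  show ?thesis
    using \<open>finite K\<close> f fw
  proof (induction K rule: finite_induct)
    case empty
    then show ?case using w by (auto simp: module_mat_simps)
  next
    case (insert x K)
    let ?S = "finsum (module_mat TYPE('a) n n) f K"
    have eq: "finsum (module_mat TYPE('a) n n) f (insert x K) = f x + ?S"
      using insert.hyps insert.prems by (subst finsum_insert) (auto simp: module_mat_simps)
    have S: "?S \<in> carrier_mat n n" "?S *\<^sub>v w = (\<Sum>r\<in>K. g r) \<cdot>\<^sub>v w"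
      using insert by auto
    have fx: "f x \<in> carrier_mat n n" "f x *\<^sub>v w = g x \<cdot>\<^sub>v w"
      using insert.prems by auto
    show ?case
      unfolding eq using S fx w insert.hyps
      by (auto simp: add_mult_distrib_mat_vec add_smult_distrib_vec)
  qed
qed

lemma weighted_perm_mat_carrier: "weighted_perm_mat u p \<in> carrier_mat (dim_vec u) (dim_vec u)"
  by (auto simp: weighted_perm_mat_def perm_mat_def mat_diag_def)

lemma gen_circulant_eigenvector:
  assumes ev: "eigenvector (weighted_perm_mat u p) w \<mu>"
  shows "eigenvector (gen_circulant u p k c) w (\<Sum>r\<in>{0..k}. c r * \<mu> ^ r)"
proof -
  let ?n = "dim_vec u" and ?P = "weighted_perm_mat u p"
  note P = weighted_perm_mat_carrier[of u p]
  have w: "w \<in> carrier_vec ?n" "w \<noteq> 0\<^sub>v ?n"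
    using ev P by (auto simp: eigenvector_def)
  have "gen_circulant u p k c \<in> carrier_mat ?n ?n \<and>
      gen_circulant u p k c *\<^sub>v w = (\<Sum>r\<in>{0..k}. c r * \<mu> ^ r) \<cdot>\<^sub>v w"
    unfolding gen_circulant_def
  proof (rule finsum_mat_mult_vec)
    fix r
    have "(c r \<cdot>\<^sub>m (?P ^\<^sub>m r)) *\<^sub>v w = c r \<cdot>\<^sub>v ((?P ^\<^sub>m r) *\<^sub>v w)"
      using P w by (intro eq_vecI) (auto simp: pow_carrier_mat)
    then show "(c r \<cdot>\<^sub>m (?P ^\<^sub>m r)) *\<^sub>v w = (c r * \<mu> ^ r) \<cdot>\<^sub>v w"
      using eigenvector_pow[OF P ev] by (simp add: smult_smult_assoc)
  qed (use P w in \<open>auto intro!: pow_carrier_mat\<close>)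
  then show ?thesis
    using w by (auto simp: eigenvector_def)
qed

section \<open>The weighted shift\<close>

lemma cyclic_shift_bounds:
  assumes "0 < m"
  shows "0 < cyclic_shift m s x" "cyclic_shift m s x \<le> m"
  using assms by (auto simp: cyclic_shift_def intro: less_imp_le)

lemma power_mod_order:
  fixes z :: "'a :: comm_monoid_mult"
  assumes "z ^ m = 1"
  shows "z ^ (x mod m) = z ^ x"
proof -
  have "z ^ x = z ^ (m * (x div m) + x mod m)" by simp
  also have "\<dots> = z ^ (x mod m)" using assms by (simp only: power_add power_mult) simp
  finally show ?thesis ..
qed

text \<open>
  An m-th root of unity does not see the wrap-around of the shift: it takes the same value at the
  representative m of the residue 0 as at 0.  This is what makes the twist below compatible
  with the cyclic structure.
\<close>

lemma power_cyclic_shift: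
  fixes z :: complex
  assumes "z ^ m = 1"
  shows "z ^ cyclic_shift m s x = z ^ (x + s)"
  using power_mod_order[OF assms, of "x + s"] assms by (auto simp: cyclic_shift_def)

lemma weighted_shift_mult_vec_index:
  assumes u: "u \<in> carrier_vec m" and v: "v \<in> carrier_vec m" and i: "i < m"
  shows "(weighted_perm_mat u (cyclic_shift m s) *\<^sub>v v) $ i
    = u $ i * v $ (cyclic_shift m s (i + 1) - 1)"
proof -
  let ?q = "cyclic_shift m s (i + 1)"
  have q: "0 < ?q" "?q \<le> m"
    using i by (auto intro!: cyclic_shift_bounds)
  have "(weighted_perm_mat u (cyclic_shift m s) *\<^sub>v v) $ i
      = (\<Sum>l<m. weighted_perm_mat u (cyclic_shift m s) $$ (i, l) * v $ l)"
    using u v i weighted_perm_mat_carrier[of u "cyclic_shift m s"]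
    by (auto simp: scalar_prod_def lessThan_atLeast0)
  also have "\<dots> = (\<Sum>l<m. if l = ?q - 1 then u $ i * v $ l else 0)"
    by (rule sum.cong) (use u i q in \<open>auto simp: weighted_perm_mat_index\<close>)
  also have "\<dots> = u $ i * v $ (?q - 1)"
    using q by (auto simp: sum.delta)
  finally show ?thesis .
qed

text \<open>
  Position l holds index l + 1, hence the exponent i + 1.  Passing from index l + 1 to its shift
  brings in the factor z ^ s, which is the same for every l and so joins the eigenvalue.
\<close>

lemma weighted_shift_eigenvector_twist:
  assumes u: "u \<in> carrier_vec m" and z: "z ^ m = 1"
    and ev: "eigenvector (weighted_perm_mat u (cyclic_shift m s)) t lam"
  shows "eigenvector (weighted_perm_mat u (cyclic_shift m s))
    (vec m (\<lambda>i. z ^ (i + 1) * t $ i)) (z ^ s * lam)"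
proof -
  let ?P = "weighted_perm_mat u (cyclic_shift m s)"
    and ?w = "vec m (\<lambda>i. z ^ (i + 1) * t $ i)"
  have P: "?P \<in> carrier_mat m m"
    using weighted_perm_mat_carrier[of u "cyclic_shift m s"] u by auto
  have t: "t \<in> carrier_vec m" "t \<noteq> 0\<^sub>v m" and Pt: "?P *\<^sub>v t = lam \<cdot>\<^sub>v t"
    using ev P by (auto simp: eigenvector_def)
  obtain i where i: "i < m" "t $ i \<noteq> 0"
    using t by (metis carrier_vecD eq_vecI index_zero_vec)
  have "z \<noteq> 0"
    using z i by (auto simp: power_0_left)
  then have "?w $ i \<noteq> 0"
    using i by simp
  then have nz: "?w \<noteq> 0\<^sub>v m"
    using i(1) by (metis index_zero_vec(1))
  have "?P *\<^sub>v ?w = (z ^ s * lam) \<cdot>\<^sub>v ?w"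
  proof (rule eq_vecI)
    fix l assume "l < dim_vec ((z ^ s * lam) \<cdot>\<^sub>v ?w)"
    then have l: "l < m" by simp
    define q where "q = cyclic_shift m s (l + 1)"
    have q: "0 < q" "q \<le> m"
      unfolding q_def using l by (auto intro!: cyclic_shift_bounds)
    have "(?P *\<^sub>v ?w) $ l = u $ l * ?w $ (q - 1)"
      using weighted_shift_mult_vec_index[OF u _ l] by (simp add: q_def)
    also have "\<dots> = z ^ q * (u $ l * t $ (q - 1))"
      using q by (cases q) auto
    also have "u $ l * t $ (q - 1) = lam * t $ l"
      using weighted_shift_mult_vec_index[OF u t(1) l, of s] Pt t l by (simp add: q_def)
    also have "z ^ q = z ^ (l + 1 + s)"
      unfolding q_def by (rule power_cyclic_shift[OF z])
    finally show "(?P *\<^sub>v ?w) $ l = ((z ^ s * lam) \<cdot>\<^sub>v ?w) $ l"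
      using l by (simp add: power_add)
  qed (use P in auto)
  then show ?thesis
    using P nz by (auto simp: eigenvector_def)
qed

section \<open>Distinctness of the eigenvalues\<close>

lemma exp_root_unity_power:
  assumes "0 < m"
  shows "exp (2 * of_real pi * \<i> / of_nat m) ^ x = cis (2 * pi * real x / real m)"
  using assms by (simp add: cis_conv_exp exp_of_nat_mult[symmetric] algebra_simps)

text \<open>
  On the exponents below m the powers of the primitive root are distinct; multiplication by s
  permutes the exponents modulo m because s is a unit there.
\<close>

lemma inj_on_root_unity_powers:
  fixes \<omega> :: complex
  assumes m: "0 < m" and cop: "coprime s m"
    and \<omega>: "\<omega> = exp (2 * of_real pi * \<i> / of_nat m)"
  shows "inj_on (\<lambda>j. \<omega> ^ (s * j)) {..<m}"
proof (rule inj_onI)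
  fix j l assume j: "j \<in> {..<m}" and l: "l \<in> {..<m}" and eq: "\<omega> ^ (s * j) = \<omega> ^ (s * l)"
  have one: "\<omega> ^ m = 1"
    using m by (simp add: \<omega> exp_root_unity_power)
  have inj: "inj_on (\<lambda>x. \<omega> ^ x) {..<m}"
    using bij_betw_imp_inj_on[OF bij_betw_roots_unity[OF m]] m
    by (simp add: \<omega> exp_root_unity_power)
  have "\<omega> ^ (s * j mod m) = \<omega> ^ (s * l mod m)"
    using eq by (simp add: power_mod_order[OF one])
  then have "[s * j = s * l] (mod m)"
    using inj_onD[OF inj] m by (simp add: cong_def)
  then have "[j = l] (mod m)"
    using cop by (simp add: cong_mult_lcancel_nat)
  then show "j = l"
    using j l by (simp add: cong_def)
qed

section \<open>The basis of twisted eigenvectors\<close>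

theorem proposition2p4:
  fixes m s k :: nat
    and u t :: "complex vec"
    and c :: "nat \<Rightarrow> complex"
    and lam \<omega> :: complex
    and P C W :: "complex mat"
  assumes "2 \<le> s" and "s \<le> m - 1" and "gcd s m = 1"
    and "u \<in> carrier_vec m"
    and "\<forall>i<m. u $ i \<noteq> 0"
    and "P = weighted_perm_mat u (cyclic_shift m s)"
    and "C = gen_circulant u (cyclic_shift m s) k c"
    and "lam ^ m = (\<Prod>i<m. u $ i)"
    and "\<omega> = exp (2 * of_real pi * \<i> / of_nat m)"
    and "eigenvector P t lam"
    and "W = mat m m (\<lambda>(i, j). \<omega> ^ ((i + 1) * j) * t $ i)"
  shows "basis_list m (cols W) \<and> (\<forall>v \<in> set (cols W). \<exists>\<mu>. eigenvector C v \<mu>)"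
proof -
  have m: "0 < m"
    using assms(1,2) by simp
  have P: "P \<in> carrier_mat m m"
    using assms(4,6) weighted_perm_mat_carrier[of u "cyclic_shift m s"] by auto
  have "\<omega> ^ m = 1"
    using m assms(9) by (simp add: exp_root_unity_power)
  then have one: "(\<omega> ^ j) ^ m = 1" for j
    by (metis power_commutes power_mult mult.commute power_one)
  have lam: "lam \<noteq> 0"
  proof
    assume "lam = 0"
    then have "(\<Prod>i<m. u $ i) = 0"
      using assms(8) m by (simp add: power_0_left)
    then show False
      using assms(5) by simp
  qed
  have col: "col W j = vec m (\<lambda>i. (\<omega> ^ j) ^ (i + 1) * t $ i)" if "j < m" for j
    using that by (intro eq_vecI)
      (simp_all add: assms(11) power_mult[symmetric] power_add mult.commute)
  have ev: "eigenvector P (col W j) (\<omega> ^ (s * j) * lam)" if "j < m" for j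
    using weighted_shift_eigenvector_twist[OF assms(4) one, of s t lam j] assms(6,10)
    by (simp add: col[OF that] power_mult[symmetric] mult.commute)
  have "coprime s m"
    using assms(3) by (simp add: coprime_iff_gcd_eq_1)
  then have inj: "inj_on (\<lambda>j. \<omega> ^ (s * j) * lam) {..<m}"
    using inj_on_root_unity_powers[OF m _ assms(9)] lam by (simp add: inj_on_def)
  have cols: "cols W = map (col W) [0..<m]"
    using assms(11) by (simp add: cols_def)
  have "basis_list m (cols W)"
    unfolding cols by (rule basis_list_eigenvectors[OF P ev inj])
  moreover have "\<exists>\<mu>. eigenvector C v \<mu>" if "v \<in> set (cols W)" for v
    using that ev gen_circulant_eigenvector unfolding cols assms(6,7) by fastforce
  ultimately show ?thesis
    by blast
qed

end
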